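(* Let $\mathbb{F}_q$ be a finite field and let $f\in\mathbb{F}_q[x]$ be a squarefree monic polynomial such that $G_f(\{1\})$ is connected. Let $D=\{f_1,f_2,\ldots,f_k\}$ ($k\ge 1$, the $f_i$ distinct) be a set of monic divisors of $f$ with $f\notin D$ such that: (1) $f_i\nmid f_j$ for all $i\ne j$; (2) the gcd-graph $G_f(D)$ is connected and anti-connected. Then $G_f(D)$ is prime.
   Context: All polynomials are monic unless stated otherwise and gcd's are taken monic (so $\gcd(0,f)=f$). For a nonzero monic $f\in\mathbb{F}_q[x]$ and a set $D$ of monic divisors of $f$ with $f\notin D$, the gcd-graph $G_f(D)$ is the undirected loopless graph with vertex set the ring $\mathbb{F}_q[x]/(f)$ in which two vertices $u,v$ are adjacent if and only if $\gcd(u-v,f)\in D$. A graph is anti-connected if its complement is connected. A homogeneous set in a graph $G$ is a set $X\subseteq V(G)$ such that every vertex in $V(G)\setminus X$ is adjacent to either all or none of the vertices of $X$; it is non-trivial if $2\le |X|<|V(G)|$. A graph is prime if it has no non-trivial homogeneous set. *)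

theory Defs
  imports
    "HOL-Computational_Algebra.Computational_Algebra"
    "Graph_Theory.Graph_Theory"
begin

text \<open>
  Graphs are the symmetric digraphs of the AFP entry Graph_Theory: an undirected edge is a pair
  of opposite arcs.  The field of coefficients is of class \<^class>\<open>field_gcd\<close>, on which the library
  bases the gcd of polynomials.  This is no restriction on the field: in a field the normalization
  is determined by the field operations, and on polynomials it makes \<^const>\<open>gcd\<close> monic
  (see \<open>gcd_poly_monic\<close> and \<open>gcd_0_poly_monic\<close>).
\<close>

lemma gcd_poly_monic:
  fixes p f :: "'a :: field_gcd poly"
  assumes "f \<noteq> 0"
  shows "lead_coeff (gcd p f) = 1"
proof -
  have "unit_factor (gcd p f) = 1" using assms by (simp add: unit_factor_gcd)
  then have "unit_factor (lead_coeff (gcd p f)) = 1"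
    by (simp add: unit_factor_poly_def one_pCons)
  moreover have "lead_coeff (gcd p f) \<noteq> 0" using assms by simp
  ultimately show ?thesis by (simp add: is_unit_unit_factor dvd_field_iff)
qed

lemma gcd_0_poly_monic:
  fixes f :: "'a :: field_gcd poly"
  assumes "lead_coeff f = 1"
  shows "gcd 0 f = f"
  using assms by (intro poly_eqI) simp

definition poly_cong_rel :: "'a :: field_gcd poly \<Rightarrow> 'a poly rel" where
  "poly_cong_rel f = {(p, q). f dvd p - q}"

lemma equiv_poly_cong_rel: "equiv UNIV (poly_cong_rel f)"
proof (rule equivI)
  show "refl (poly_cong_rel f)" by (auto simp: refl_on_def poly_cong_rel_def)
  show "sym (poly_cong_rel f)"
    by (auto intro!: symI simp: poly_cong_rel_def dvd_diff_commute)
  show "trans (poly_cong_rel f)"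
  proof (rule transI)
    fix p q r assume "(p, q) \<in> poly_cong_rel f" "(q, r) \<in> poly_cong_rel f"
    then have "f dvd (p - q) + (q - r)" unfolding poly_cong_rel_def by (intro dvd_add) auto
    then show "(p, r) \<in> poly_cong_rel f" by (simp add: poly_cong_rel_def)
  qed
qed simp

definition poly_residue_classes :: "'a :: field_gcd poly \<Rightarrow> 'a poly set set" where
  "poly_residue_classes f = UNIV // poly_cong_rel f"

text \<open>
  The gcd of a difference of two residue classes with \<open>f\<close> does not depend on the representatives
  (see \<open>gcd_graph_adjacent_iff\<close>).
\<close>

definition gcd_graph ::
    "'a :: field_gcd poly \<Rightarrow> 'a poly set \<Rightarrow> 'a poly set pair_pre_digraph" where
  "gcd_graph f D =
     \<lparr> pverts = poly_residue_classes f,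
       parcs = {(u, v). u \<in> poly_residue_classes f \<and> v \<in> poly_residue_classes f \<and>
                        (\<exists>p\<in>u. \<exists>q\<in>v. gcd (p - q) f \<in> D)} \<rparr>"

lemma gcd_graph_adjacent_iff:
  "(poly_cong_rel f `` {p}, poly_cong_rel f `` {q}) \<in> parcs (gcd_graph f D) \<longleftrightarrow> gcd (p - q) f \<in> D"
proof -
  have eq: "gcd (p' - q') f = gcd (p - q) f"
    if "f dvd p - p'" "f dvd q - q'" for p' q'
  proof -
    have "f dvd (p - p') - (q - q')" using that by (rule dvd_diff)
    then obtain k where k: "(p - p') - (q - q') = f * k" by (elim dvdE)
    then have "p - q = k * f + (p' - q')" by (simp add: algebra_simps)
    then show ?thesis by (metis gcd.commute gcd_add_mult)
  qed
  have "poly_cong_rel f `` {r} \<in> poly_residue_classes f" for r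
    unfolding poly_residue_classes_def by (rule quotientI) simp
  then have "(poly_cong_rel f `` {p}, poly_cong_rel f `` {q}) \<in> parcs (gcd_graph f D) \<longleftrightarrow>
      (\<exists>p'\<in>poly_cong_rel f `` {p}. \<exists>q'\<in>poly_cong_rel f `` {q}. gcd (p' - q') f \<in> D)"
    by (simp add: gcd_graph_def)
  also have "\<dots> \<longleftrightarrow> (\<exists>p' q'. f dvd p - p' \<and> f dvd q - q' \<and> gcd (p' - q') f \<in> D)"
    by (simp add: poly_cong_rel_def)
  also have "\<dots> \<longleftrightarrow> gcd (p - q) f \<in> D"
  proof
    assume "\<exists>p' q'. f dvd p - p' \<and> f dvd q - q' \<and> gcd (p' - q') f \<in> D"
    then obtain p' q' where "f dvd p - p'" "f dvd q - q'" "gcd (p' - q') f \<in> D" by blast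
    then show "gcd (p - q) f \<in> D" by (simp only: eq)
  next
    assume "gcd (p - q) f \<in> D"
    then show "\<exists>p' q'. f dvd p - p' \<and> f dvd q - q' \<and> gcd (p' - q') f \<in> D"
      by (intro exI[of _ p] exI[of _ q]) simp
  qed
  finally show ?thesis .
qed

lemma poly_residue_class_cases:
  assumes "u \<in> poly_residue_classes f"
  obtains p where "u = poly_cong_rel f `` {p}"
  using assms unfolding poly_residue_classes_def by (auto elim: quotientE)

lemma finite_poly_residue_classes:
  fixes f :: "'a :: {finite, field_gcd} poly"
  assumes "f \<noteq> 0"
  shows "finite (poly_residue_classes f)"
proof -
  let ?B = "Poly ` {xs :: 'a list. set xs \<subseteq> UNIV \<and> length xs \<le> Suc (degree f)}"
  have "finite ?B"
    using finite_lists_length_le[of "UNIV :: 'a set"] by (intro finite_imageI) simp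
  moreover have "poly_residue_classes f \<subseteq> (\<lambda>p. poly_cong_rel f `` {p}) ` ?B"
  proof
    fix u assume "u \<in> poly_residue_classes f"
    then obtain p where u: "u = poly_cong_rel f `` {p}" by (rule poly_residue_class_cases)
    have "(p, p mod f) \<in> poly_cong_rel f"
      by (simp add: poly_cong_rel_def minus_mod_eq_mult_div)
    then have "u = poly_cong_rel f `` {p mod f}"
      unfolding u by (rule equiv_class_eq[OF equiv_poly_cong_rel])
    moreover have "length (coeffs (p mod f)) \<le> Suc (degree f)"
      using degree_mod_less[OF assms, of p] by (cases "p mod f = 0") (auto simp: length_coeffs)
    then have "Poly (coeffs (p mod f)) \<in> ?B" by blast
    then have "p mod f \<in> ?B" by simp
    ultimately show "u \<in> (\<lambda>p. poly_cong_rel f `` {p}) ` ?B" by blast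
  qed
  ultimately show ?thesis by (meson finite_imageI finite_subset)
qed

lemma pair_graph_gcd_graph:
  fixes f :: "'a :: {finite, field_gcd} poly"
  assumes "lead_coeff f = 1" and "f \<notin> D"
  shows "pair_graph (gcd_graph f D)"
proof -
  have f0: "f \<noteq> 0" using assms(1) by auto
  note fin = finite_poly_residue_classes[OF f0]
  have sub: "parcs (gcd_graph f D) \<subseteq> poly_residue_classes f \<times> poly_residue_classes f"
    by (auto simp: gcd_graph_def)
  have sy: "(v, u) \<in> parcs (gcd_graph f D)" if a: "(u, v) \<in> parcs (gcd_graph f D)" for u v
  proof -
    from a sub have "u \<in> poly_residue_classes f" "v \<in> poly_residue_classes f" by auto
    then obtain p q where pq: "u = poly_cong_rel f `` {p}" "v = poly_cong_rel f `` {q}"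
      by (meson poly_residue_class_cases)
    have "gcd (q - p) f = gcd (p - q) f" by (metis gcd_neg1 minus_diff_eq)
    with a show ?thesis by (simp add: pq gcd_graph_adjacent_iff)
  qed
  have lf: "fst e \<noteq> snd e" if a: "e \<in> parcs (gcd_graph f D)" for e
  proof
    assume eq: "fst e = snd e"
    from a sub have "fst e \<in> poly_residue_classes f" by auto
    then obtain p where "fst e = poly_cong_rel f `` {p}" by (rule poly_residue_class_cases)
    with a eq have "gcd (p - p) f \<in> D"
      by (metis gcd_graph_adjacent_iff prod.collapse)
    with assms show False by (simp only: diff_self gcd_0_poly_monic)
  qed
  show ?thesis
  proof unfold_locales
    show "symmetric (with_proj (gcd_graph f D))"
      using sy by (auto simp: symmetric_def sym_def)
  next
    show "finite (parcs (gcd_graph f D))"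
      using sub fin by (meson finite_SigmaI finite_subset)
  next
    show "finite (pverts (gcd_graph f D))"
      using fin by (simp add: gcd_graph_def)
  qed (use sub lf in \<open>auto simp: gcd_graph_def\<close>)
qed

definition complement_graph :: "'v pair_pre_digraph \<Rightarrow> 'v pair_pre_digraph" where
  "complement_graph G =
     \<lparr> pverts = pverts G,
       parcs = {(u, v). u \<in> pverts G \<and> v \<in> pverts G \<and> u \<noteq> v \<and> (u, v) \<notin> parcs G} \<rparr>"

definition anti_connected :: "'v pair_pre_digraph \<Rightarrow> bool" where
  "anti_connected G \<longleftrightarrow> connected (with_proj (complement_graph G))"

definition homogeneous_set :: "'v pair_pre_digraph \<Rightarrow> 'v set \<Rightarrow> bool" where
  "homogeneous_set G X \<longleftrightarrow>
     X \<subseteq> pverts G \<and>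
     (\<forall>v \<in> pverts G - X. (\<forall>x\<in>X. (v, x) \<in> parcs G) \<or> (\<forall>x\<in>X. (v, x) \<notin> parcs G))"

text \<open>Meant for finite graphs, as \<^const>\<open>card\<close> is \<open>0\<close> on infinite sets.\<close>

definition prime_graph :: "'v pair_pre_digraph \<Rightarrow> bool" where
  "prime_graph G \<longleftrightarrow>
     \<not> (\<exists>X. homogeneous_set G X \<and> 2 \<le> card X \<and> card X < card (pverts G))"

end

theory Submission
  imports Defs
begin

text \<open>
  Vertices are handled through their representatives: a vertex set becomes a set of polynomials
  that is a union of residue classes modulo \<open>f\<close>, and adjacency becomes the relation
  \<open>gcd (p - q) f \<in> D\<close>.  This relation is invariant under translations and under multiplication
  by units modulo \<open>f\<close>.

  Suppose that there is a non-trivial homogeneous set.  By translation it may be assumed to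
  contain \<open>0\<close>; let \<open>M\<close> be maximal among the proper homogeneous sets containing \<open>0\<close>.  If two proper
  homogeneous sets meet, then their union is homogeneous, and it is again proper because the graph
  is connected and anti-connected (\<open>union_of_proper_homogeneous_neq_UNIV\<close>).  So \<open>M\<close> contains
  every proper homogeneous set through \<open>0\<close>.  Applied to the translates \<open>M - a\<close> with \<open>a \<in> M\<close> and to
  the multiples \<open>u M\<close> with \<open>u\<close> a unit modulo \<open>f\<close>, this shows that \<open>M\<close> is an additive subgroup
  stable under units.  Connectedness of \<open>G\<^sub>f({1})\<close> says that the units modulo \<open>f\<close> generate the
  residue ring additively, hence \<open>M\<close> is an ideal.  It contains \<open>f\<close>, so it is generated by some
  divisor \<open>g\<close> of \<open>f\<close>, which is neither a unit nor an associate of \<open>f\<close>.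

  Write \<open>f = g h\<close>; here \<open>g\<close> and \<open>h\<close> are coprime because \<open>f\<close> is squarefree.  If some \<open>d \<in> D\<close> were
  not a multiple of \<open>g\<close>, then homogeneity would put the gcd of \<open>d - x\<close> with \<open>f\<close> into \<open>D\<close> for all
  \<open>x \<in> M\<close>.  By the Chinese remainder theorem the factor of this gcd that divides \<open>h\<close> can be
  prescribed while the factor dividing \<open>g\<close> stays, against the assumption that \<open>D\<close> is an antichain
  (\<open>homogeneous_ideal_generator_dvd\<close>).  So all elements of \<open>D\<close> are multiples of \<open>g\<close>; then adjacent
  vertices are congruent modulo the non-unit \<open>g\<close>, and the graph is not connected.
\<close>

section \<open>Homogeneous sets of a relation\<close>

definition rel_homogeneous :: "('v \<Rightarrow> 'v \<Rightarrow> bool) \<Rightarrow> 'v set \<Rightarrow> bool" where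
  "rel_homogeneous E P \<longleftrightarrow> (\<forall>v. v \<notin> P \<longrightarrow> (\<forall>x\<in>P. \<forall>y\<in>P. E v x \<longleftrightarrow> E v y))"

lemma rel_homogeneousD:
  "rel_homogeneous E P \<Longrightarrow> v \<notin> P \<Longrightarrow> x \<in> P \<Longrightarrow> y \<in> P \<Longrightarrow> E v x \<longleftrightarrow> E v y"
  unfolding rel_homogeneous_def by blast

lemma rel_homogeneous_Un:
  assumes "rel_homogeneous E P" "rel_homogeneous E Q" "z \<in> P" "z \<in> Q"
  shows "rel_homogeneous E (P \<union> Q)"
  using assms unfolding rel_homogeneous_def by (metis Un_iff)

lemma rel_homogeneous_vimage:
  assumes "rel_homogeneous E P" "\<And>x y. E (\<phi> x) (\<phi> y) \<longleftrightarrow> E x y"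
  shows "rel_homogeneous E (\<phi> -` P)"
  using assms unfolding rel_homogeneous_def by (metis vimage_eq)

text \<open>
  This is the step that excludes a union of two proper homogeneous sets from being the whole
  vertex set: one of the graph and its complement would have no edge leaving \<open>P\<close>.  If the union
  is everything, a vertex \<open>v\<close> outside \<open>P\<close> lies in \<open>Q\<close>, so that homogeneity of \<open>P\<close>
  lets its neighbour in \<open>P\<close> be moved to a fixed \<open>x \<notin> Q\<close>, and homogeneity of \<open>Q\<close> lets \<open>v\<close> itself
  be moved to a fixed \<open>y \<notin> P\<close>.
\<close>

lemma complete_or_anticomplete_to_complement:
  assumes sym: "\<And>x y. E x y \<longleftrightarrow> E y x"
    and P: "rel_homogeneous E P" "P \<noteq> UNIV"
    and Q: "rel_homogeneous E Q" "Q \<noteq> UNIV"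
    and UN: "P \<union> Q = UNIV"
  shows "(\<forall>w\<in>P. \<forall>v. v \<notin> P \<longrightarrow> E w v) \<or> (\<forall>w\<in>P. \<forall>v. v \<notin> P \<longrightarrow> \<not> E w v)"
proof -
  obtain x y where x: "x \<notin> Q" and y: "y \<notin> P" using P(2) Q(2) by blast
  have "E w v \<longleftrightarrow> E x y" if "w \<in> P" "v \<notin> P" for w v
  proof -
    have "E v w \<longleftrightarrow> E v x" using rel_homogeneousD[OF P(1)] that x UN by blast
    moreover have "E x v \<longleftrightarrow> E x y" using rel_homogeneousD[OF Q(1)] that x y UN by blast
    ultimately show ?thesis using sym by blast
  qed
  then show ?thesis by blast
qed

section \<open>Connectedness in terms of representatives\<close>

lemma connected_closed_set:
  assumes con: "connected (with_proj G)"
    and sym: "\<And>u v. (u, v) \<in> parcs G \<Longrightarrow> (v, u) \<in> parcs G"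
    and x: "x \<in> pverts G" "x \<in> S"
    and closed: "\<And>u v. u \<in> S \<Longrightarrow> (u, v) \<in> parcs G \<Longrightarrow> v \<in> S"
  shows "pverts G \<subseteq> S"
proof
  fix y assume y: "y \<in> pverts G"
  have "x \<rightarrow>\<^sup>*\<^bsub>mk_symmetric (with_proj G)\<^esub> y"
    using con x(1) y unfolding connected_def strongly_connected_def by simp
  then have "(x, y) \<in> (arcs_ends (mk_symmetric (with_proj G)))\<^sup>*"
    by (rule reachable_rtranclI)
  then show "y \<in> S"
  proof (induction rule: rtrancl_induct)
    case base
    show ?case by (rule x(2))
  next
    case (step u v)
    have "(u, v) \<in> parcs G \<or> (v, u) \<in> parcs G"
      using step(2) by (auto simp: parcs_mk_symmetric)
    then show ?case using sym closed step by blast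
  qed
qed

definition residue_closed :: "'a :: field_gcd poly \<Rightarrow> 'a poly set \<Rightarrow> bool" where
  "residue_closed f P \<longleftrightarrow> (\<forall>p q. p \<in> P \<longrightarrow> f dvd p - q \<longrightarrow> q \<in> P)"

lemma residue_closedD: "residue_closed f P \<Longrightarrow> p \<in> P \<Longrightarrow> f dvd p - q \<Longrightarrow> q \<in> P"
  unfolding residue_closed_def by blast

lemma residue_class_eq_iff:
  "poly_cong_rel f `` {p} = poly_cong_rel f `` {q} \<longleftrightarrow> f dvd p - q"
  by (subst eq_equiv_class_iff[OF equiv_poly_cong_rel]) (simp_all add: poly_cong_rel_def)

lemma residue_class_in_vertices: "poly_cong_rel f `` {p} \<in> poly_residue_classes f"
  unfolding poly_residue_classes_def by (rule quotientI) simp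

lemma residue_class_in_image_iff:
  assumes "residue_closed f P"
  shows "poly_cong_rel f `` {p} \<in> (\<lambda>p. poly_cong_rel f `` {p}) ` P \<longleftrightarrow> p \<in> P"
  using assms by (metis (no_types, lifting) image_iff residue_class_eq_iff residue_closedD)

lemma gcd_diff_commute: "gcd (p - q) f = gcd (q - p) (f :: 'a :: field_gcd poly)"
  by (metis gcd_neg1 minus_diff_eq)

text \<open>
  A graph on the residue classes is described here by the relation \<open>E\<close> that its arcs induce on
  representatives, so that the rule applies to a gcd-graph and to its complement alike.
\<close>

lemma connected_residue_closed_UNIV:
  fixes f :: "'a :: field_gcd poly"
  assumes con: "connected (with_proj G)"
    and verts: "pverts G = poly_residue_classes f"
    and arcs: "parcs G \<subseteq> pverts G \<times> pverts G"
    and E: "\<And>p q. (poly_cong_rel f `` {p}, poly_cong_rel f `` {q}) \<in> parcs G \<Longrightarrow> E p q"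
    and sym: "\<And>u v. (u, v) \<in> parcs G \<Longrightarrow> (v, u) \<in> parcs G"
    and P: "residue_closed f P" "0 \<in> P"
    and closed: "\<And>p q. p \<in> P \<Longrightarrow> E p q \<Longrightarrow> q \<in> P"
  shows "P = UNIV"
proof -
  let ?c = "\<lambda>p. poly_cong_rel f `` {p}"
  have "pverts G \<subseteq> ?c ` P"
  proof (rule connected_closed_set[OF con sym])
    show "?c 0 \<in> pverts G" by (simp only: verts residue_class_in_vertices)
    show "?c 0 \<in> ?c ` P" using P(2) by (rule imageI)
    fix u v assume u: "u \<in> ?c ` P" and uv: "(u, v) \<in> parcs G"
    obtain p where p: "u = ?c p" "p \<in> P" using u by blast
    have "v \<in> poly_residue_classes f" using uv arcs verts by blast
    then obtain q where q: "v = ?c q" by (rule poly_residue_class_cases)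
    show "v \<in> ?c ` P" using p q uv E closed by blast
  qed
  then show ?thesis
    using residue_class_in_image_iff[OF P(1)] residue_class_in_vertices verts by blast
qed

lemma gcd_graph_arcs_sym:
  assumes "(u, v) \<in> parcs (gcd_graph f D)"
  shows "(v, u) \<in> parcs (gcd_graph f D)"
  using assms unfolding gcd_graph_def by simp (metis gcd_diff_commute)

lemma connected_gcd_graph_residue_closed:
  assumes "connected (with_proj (gcd_graph f D))" "residue_closed f P" "0 \<in> P"
    and "\<And>p q. p \<in> P \<Longrightarrow> gcd (p - q) f \<in> D \<Longrightarrow> q \<in> P"
  shows "P = UNIV"
proof (rule connected_residue_closed_UNIV[where E = "\<lambda>p q. gcd (p - q) f \<in> D", OF assms(1)])
  show "pverts (gcd_graph f D) = poly_residue_classes f" by (simp add: gcd_graph_def)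
  show "parcs (gcd_graph f D) \<subseteq> pverts (gcd_graph f D) \<times> pverts (gcd_graph f D)"
    by (auto simp: gcd_graph_def)
qed (use assms gcd_graph_arcs_sym gcd_graph_adjacent_iff in blast)+

lemma anti_connected_gcd_graph_residue_closed:
  assumes "anti_connected (gcd_graph f D)" "residue_closed f P" "0 \<in> P"
    and "\<And>p q. p \<in> P \<Longrightarrow> gcd (p - q) f \<notin> D \<Longrightarrow> q \<in> P"
  shows "P = UNIV"
proof (rule connected_residue_closed_UNIV[where E = "\<lambda>p q. gcd (p - q) f \<notin> D",
      OF assms(1)[unfolded anti_connected_def]])
  let ?H = "complement_graph (gcd_graph f D)"
  show "pverts ?H = poly_residue_classes f" by (simp add: complement_graph_def gcd_graph_def)
  show "parcs ?H \<subseteq> pverts ?H \<times> pverts ?H" by (auto simp: complement_graph_def)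
  show "(v, u) \<in> parcs ?H" if "(u, v) \<in> parcs ?H" for u v
    using that gcd_graph_arcs_sym[of v u] by (auto simp: complement_graph_def)
  show "gcd (p - q) f \<notin> D"
    if "(poly_cong_rel f `` {p}, poly_cong_rel f `` {q}) \<in> parcs ?H" for p q
    using that gcd_graph_adjacent_iff[of f p q D] by (auto simp: complement_graph_def)
qed (use assms in blast)+

section \<open>The largest proper homogeneous set through zero\<close>

text \<open>
  Containing \<open>0\<close> makes any two of these sets meet; in a translation-invariant graph it only
  fixes one set among its translates.
\<close>

definition proper_homogeneous :: "'a :: field_gcd poly \<Rightarrow> 'a poly set \<Rightarrow> 'a poly set \<Rightarrow> bool" where
  "proper_homogeneous f D P \<longleftrightarrow> residue_closed f P \<and>
     rel_homogeneous (\<lambda>p q. gcd (p - q) f \<in> D) P \<and> 0 \<in> P \<and> P \<noteq> UNIV"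

lemma proper_homogeneous_translate:
  assumes closed: "residue_closed f P"
    and hom: "rel_homogeneous (\<lambda>p q. gcd (p - q) f \<in> D) P"
    and proper: "P \<noteq> UNIV" and a: "a \<in> P"
  shows "proper_homogeneous f D {p. p + a \<in> P}"
proof -
  have "residue_closed f {p. p + a \<in> P}"
    unfolding residue_closed_def using residue_closedD[OF closed]
    by (metis (no_types, lifting) add_diff_cancel_right mem_Collect_eq)
  moreover have "rel_homogeneous (\<lambda>p q. gcd (p - q) f \<in> D) ((\<lambda>p. p + a) -` P)"
    by (rule rel_homogeneous_vimage[OF hom]) simp
  moreover have "{p. p + a \<in> P} \<noteq> UNIV"
  proof
    assume eq: "{p. p + a \<in> P} = UNIV"
    have "q \<in> P" for q using eq[THEN eqset_imp_iff, of "q - a"] by simp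
    then show False using proper by blast
  qed
  ultimately show ?thesis using a by (simp add: proper_homogeneous_def vimage_def)
qed

lemma union_of_proper_homogeneous_neq_UNIV:
  assumes con: "connected (with_proj (gcd_graph f D))"
    and anti: "anti_connected (gcd_graph f D)"
    and P: "proper_homogeneous f D P" and Q: "proper_homogeneous f D Q"
  shows "P \<union> Q \<noteq> UNIV"
proof
  assume UN: "P \<union> Q = UNIV"
  let ?E = "\<lambda>p q. gcd (p - q) f \<in> D"
  note P = P[unfolded proper_homogeneous_def] and Q = Q[unfolded proper_homogeneous_def]
  have "(\<forall>w\<in>P. \<forall>v. v \<notin> P \<longrightarrow> ?E w v) \<or> (\<forall>w\<in>P. \<forall>v. v \<notin> P \<longrightarrow> \<not> ?E w v)"
    by (rule complete_or_anticomplete_to_complement[of ?E P Q])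
      (use P Q UN in \<open>auto simp: gcd_diff_commute\<close>)
  then have "P = UNIV"
  proof
    assume "\<forall>w\<in>P. \<forall>v. v \<notin> P \<longrightarrow> ?E w v"
    then show ?thesis
      by (intro anti_connected_gcd_graph_residue_closed[OF anti]) (use P in blast)+
  next
    assume "\<forall>w\<in>P. \<forall>v. v \<notin> P \<longrightarrow> \<not> ?E w v"
    then show ?thesis
      by (intro connected_gcd_graph_residue_closed[OF con]) (use P in blast)+
  qed
  then show False using P by blast
qed

lemma finite_residue_closed_sets:
  fixes f :: "'a :: {finite, field_gcd} poly"
  assumes "f \<noteq> 0"
  shows "finite {P. residue_closed f P}"
proof (rule finite_imageD)
  let ?c = "\<lambda>p. poly_cong_rel f `` {p}"
  have "image ?c ` {P. residue_closed f P} \<subseteq> Pow (poly_residue_classes f)"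
    using residue_class_in_vertices by blast
  then show "finite (image ?c ` {P. residue_closed f P})"
    using finite_poly_residue_classes[OF assms] by (meson finite_Pow_iff finite_subset)
  show "inj_on (image ?c) {P. residue_closed f P}"
  proof (rule inj_onI)
    fix P Q assume "P \<in> {P. residue_closed f P}" "Q \<in> {P. residue_closed f P}" "?c ` P = ?c ` Q"
    then have "p \<in> P \<longleftrightarrow> p \<in> Q" for p
      using residue_class_in_image_iff[of f P p] residue_class_in_image_iff[of f Q p] by simp
    then show "P = Q" by blast
  qed
qed

text \<open>
  The union of two proper homogeneous sets through \<open>0\<close> is another one, so a
  maximal one, which exists because there are finitely many residue classes, is the largest.
\<close>

lemma largest_proper_homogeneous:
  fixes f :: "'a :: {finite, field_gcd} poly"
  assumes f: "f \<noteq> 0"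
    and con: "connected (with_proj (gcd_graph f D))"
    and anti: "anti_connected (gcd_graph f D)"
    and P: "proper_homogeneous f D P"
  obtains M where "proper_homogeneous f D M" "\<And>Q. proper_homogeneous f D Q \<Longrightarrow> Q \<subseteq> M"
proof -
  let ?\<H> = "{Q. proper_homogeneous f D Q}"
  have "finite ?\<H>"
    by (rule finite_subset[OF _ finite_residue_closed_sets[OF f]])
      (auto simp: proper_homogeneous_def)
  then obtain M where M: "M \<in> ?\<H>" and max: "\<forall>Q\<in>?\<H>. M \<subseteq> Q \<longrightarrow> M = Q"
    using finite_has_maximal[of ?\<H>] P by blast
  have "Q \<subseteq> M" if Q: "proper_homogeneous f D Q" for Q
  proof -
    have "M \<union> Q \<noteq> UNIV" using union_of_proper_homogeneous_neq_UNIV[OF con anti] M Q by blast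
    moreover have "residue_closed f (M \<union> Q)"
      using M Q unfolding proper_homogeneous_def residue_closed_def by blast
    moreover have "rel_homogeneous (\<lambda>p q. gcd (p - q) f \<in> D) (M \<union> Q)"
      by (rule rel_homogeneous_Un[of _ _ _ 0]) (use M Q in \<open>auto simp: proper_homogeneous_def\<close>)
    ultimately have "M \<union> Q \<in> ?\<H>" using M unfolding proper_homogeneous_def by blast
    then show ?thesis using max by blast
  qed
  then show ?thesis using that M by blast
qed

section \<open>The largest proper homogeneous set is an ideal\<close>

lemma unit_mod_inverse:
  fixes f u :: "'a :: field_gcd poly"
  assumes "coprime u f"
  obtains w where "coprime w f" "f dvd w * u - 1"
proof -
  obtain a b where ab: "a * u + b * f = 1"
    using assms bezout_coefficients_fst_snd[of u f] by (metis coprime_imp_gcd_eq_1)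
  have "a * u - 1 = f * (- b)" using ab by (simp add: algebra_simps)
  then have "f dvd a * u - 1" by (metis dvd_triv_left)
  moreover have "coprime a f"
  proof (rule coprimeI)
    fix c assume c: "c dvd a" "c dvd f"
    then have "c dvd a * u + b * f" by (intro dvd_add dvd_mult dvd_mult2) auto
    then show "is_unit c" using ab by simp
  qed
  ultimately show ?thesis using that by blast
qed

text \<open>
  The set below is \<open>w\<^sup>-\<^sup>1 M\<close>.  As the inverse of a unit is a unit, these preimages are all the
  multiples of \<open>M\<close> by units.
\<close>

lemma proper_homogeneous_unit_multiple:
  assumes M: "proper_homogeneous f D M" and w: "coprime w f"
  shows "proper_homogeneous f D {p. w * p \<in> M}"
proof -
  note M = M[unfolded proper_homogeneous_def]
  have "residue_closed f {p. w * p \<in> M}"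
    unfolding residue_closed_def using residue_closedD[of f M] M
    by (metis (no_types, lifting) dvd_mult mem_Collect_eq right_diff_distrib)
  moreover have "rel_homogeneous (\<lambda>p q. gcd (p - q) f \<in> D) ((*) w -` M)"
  proof (rule rel_homogeneous_vimage)
    show "(gcd (w * x - w * y) f \<in> D) = (gcd (x - y) f \<in> D)" for x y
      using gcd_mult_left_left_cancel[of f w "x - y"] w
      by (simp add: coprime_commute flip: right_diff_distrib)
  qed (use M in auto)
  moreover have "{p. w * p \<in> M} \<noteq> UNIV"
  proof
    assume eq: "{p. w * p \<in> M} = UNIV"
    obtain u where u: "f dvd u * w - 1" using unit_mod_inverse[OF w] by blast
    have "q \<in> M" for q
    proof (rule residue_closedD[of f M])
      show "w * (u * q) \<in> M" using eq by blast
      have "w * (u * q) - q = (u * w - 1) * q" by (simp add: algebra_simps)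
      then show "f dvd w * (u * q) - q" using u by simp
    qed (use M in blast)
    then show False using M by blast
  qed
  ultimately show ?thesis using M by (simp add: proper_homogeneous_def vimage_def)
qed

text \<open>
  The multipliers preserving \<open>M\<close> include \<open>0\<close> and are stable under subtracting units modulo \<open>f\<close>,
  that is, under walking along edges of \<open>G\<^sub>f({1})\<close>.
\<close>

lemma largest_proper_homogeneous_ideal:
  fixes f :: "'a :: field_gcd poly"
  assumes units: "connected (with_proj (gcd_graph f {1}))"
    and M: "proper_homogeneous f D M"
    and max: "\<And>Q. proper_homogeneous f D Q \<Longrightarrow> Q \<subseteq> M"
  shows "\<And>x y. x \<in> M \<Longrightarrow> y \<in> M \<Longrightarrow> x - y \<in> M"
    and "\<And>r x. x \<in> M \<Longrightarrow> r * x \<in> M"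
proof -
  have cl: "residue_closed f M" and 0: "0 \<in> M" using M by (auto simp: proper_homogeneous_def)
  show diff: "x - y \<in> M" if "x \<in> M" "y \<in> M" for x y
  proof -
    have "proper_homogeneous f D {p. p + y \<in> M}"
      by (rule proper_homogeneous_translate) (use M that in \<open>auto simp: proper_homogeneous_def\<close>)
    then show ?thesis using max that by fastforce
  qed
  have unit: "u * x \<in> M" if u: "coprime u f" and x: "x \<in> M" for u x
  proof -
    obtain w where w: "coprime w f" "f dvd w * u - 1" using unit_mod_inverse[OF u] by blast
    have "x - w * (u * x) = - ((w * u - 1) * x)" by (simp add: algebra_simps)
    then have "f dvd x - w * (u * x)" using w(2) by simp
    then have "w * (u * x) \<in> M" using residue_closedD[OF cl x] by blast
    then show ?thesis using max[OF proper_homogeneous_unit_multiple[OF M w(1)]] by auto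
  qed
  have multiples: "f * k \<in> M" for k
    using residue_closedD[OF cl 0, of "f * k"] by simp
  have "{r. \<forall>x\<in>M. r * x \<in> M} = UNIV"
  proof (rule connected_gcd_graph_residue_closed[OF units])
    show "0 \<in> {r. \<forall>x\<in>M. r * x \<in> M}" using 0 by simp
    show "residue_closed f {r. \<forall>x\<in>M. r * x \<in> M}"
      unfolding residue_closed_def
    proof (intro allI impI CollectI ballI)
      fix r s x assume r: "r \<in> {r. \<forall>x\<in>M. r * x \<in> M}" and "f dvd r - s" and x: "x \<in> M"
      then obtain k where k: "r - s = f * k" by (elim dvdE)
      have "s * x = r * x - (r - s) * x" by (simp add: algebra_simps)
      also have "\<dots> = r * x - f * (k * x)" by (simp only: k mult.assoc)
      also have "\<dots> \<in> M" using diff multiples r x by blast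
      finally show "s * x \<in> M" .
    qed
    fix r s assume r: "r \<in> {r. \<forall>x\<in>M. r * x \<in> M}" and "gcd (r - s) f \<in> {1}"
    then have u: "coprime (r - s) f" by (simp add: coprime_iff_gcd_eq_1)
    have "s * x \<in> M" if x: "x \<in> M" for x
    proof -
      have "s * x = r * x - (r - s) * x" by (simp add: algebra_simps)
      also have "\<dots> \<in> M" using diff unit[OF u x] r x by blast
      finally show ?thesis .
    qed
    then show "s \<in> {r. \<forall>x\<in>M. r * x \<in> M}" by blast
  qed
  then show "r * x \<in> M" if "x \<in> M" for r x using that by blast
qed

lemma poly_ideal_principal:
  fixes M :: "'a :: field_gcd poly set"
  assumes diff: "\<And>x y. x \<in> M \<Longrightarrow> y \<in> M \<Longrightarrow> x - y \<in> M"
    and mult: "\<And>r x. x \<in> M \<Longrightarrow> r * x \<in> M"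
    and f: "f \<in> M" "f \<noteq> 0"
  obtains g where "M = {p. g dvd p}"
proof -
  obtain g where g: "g \<in> M" "g \<noteq> 0" and min: "\<And>p. p \<in> M \<Longrightarrow> p \<noteq> 0 \<Longrightarrow> degree g \<le> degree p"
    using f ex_has_least_nat[of "\<lambda>p. p \<in> M \<and> p \<noteq> 0" f degree] by blast
  have "g dvd p" if p: "p \<in> M" for p
  proof -
    have "p mod g = p - (p div g) * g" by (simp add: minus_div_mult_eq_mod)
    then have "p mod g \<in> M" using diff mult p g(1) by metis
    then have "p mod g = 0" using min degree_mod_less[OF g(2), of p] by fastforce
    then show ?thesis by (rule mod_0_imp_dvd)
  qed
  moreover have "p \<in> M" if "g dvd p" for p
    using that mult[OF g(1)] by (metis dvdE mult.commute)
  ultimately show ?thesis using that by blast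
qed

section \<open>Homogeneous ideals and antichains of divisors\<close>

text \<open>
  Suppose \<open>g\<close> does not divide \<open>d\<close>.  As \<open>d\<close> is adjacent to \<open>0\<close>, it is adjacent to all multiples
  \<open>x\<close> of \<open>g\<close>.  Choosing \<open>x\<close> with \<open>d - x\<close> divisible by \<open>h\<close> gives an element of \<open>D\<close> divisible by
  \<open>d\<close> and \<open>h\<close>, and choosing it with \<open>d - x \<equiv> 1\<close> modulo \<open>h\<close> gives a divisor of \<open>d\<close> in \<open>D\<close>
  coprime to \<open>h\<close>.  In an antichain both are \<open>d\<close>, so \<open>h\<close> is a unit.
\<close>

lemma homogeneous_ideal_generator_dvd:
  fixes g h :: "'a :: field_gcd poly"
  assumes cop: "coprime g h" and h: "\<not> is_unit h"
    and hom: "rel_homogeneous (\<lambda>p q. gcd (p - q) (g * h) \<in> D) {p. g dvd p}"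
    and divisor: "\<And>d. d \<in> D \<Longrightarrow> lead_coeff d = 1 \<and> d dvd g * h"
    and antichain: "\<And>a b. a \<in> D \<Longrightarrow> b \<in> D \<Longrightarrow> a \<noteq> b \<Longrightarrow> \<not> a dvd b"
    and d: "d \<in> D"
  shows "g dvd d"
proof (rule ccontr)
  assume gd: "\<not> g dvd d"
  obtain a b where ab: "a * g + b * h = 1"
    using cop bezout_coefficients_fst_snd[of g h] by (metis coprime_imp_gcd_eq_1)
  have "normalize d = d"
    using divisor[OF d] by (simp add: normalize_poly_eq_map_poly)
  then have "gcd (d - 0) (g * h) \<in> D"
    using divisor[OF d] d by (simp add: gcd_proj1_if_dvd)
  then have all: "gcd (d - x) (g * h) \<in> D" if "g dvd x" for x
    using rel_homogeneousD[OF hom, of d 0 x] gd that by simp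
  have "h dvd d"
  proof -
    define e where "e = gcd (d - d * (a * g)) (g * h)"
    have "e \<in> D" unfolding e_def by (rule all) simp
    have "d - d * (a * g) = d * (1 - a * g)" by (simp add: algebra_simps)
    also have "1 - a * g = b * h" using ab by (simp add: algebra_simps)
    finally have eq: "d - d * (a * g) = d * (b * h)" .
    have "d dvd e" unfolding e_def eq using divisor[OF d] by simp
    then have "e = d" using antichain[OF d \<open>e \<in> D\<close>] by blast
    moreover have "h dvd e" unfolding e_def eq by simp
    ultimately show ?thesis by simp
  qed
  moreover have "coprime d h"
  proof -
    define y where "y = (d - 1) * (a * g)"
    define e where "e = gcd (d - y) (g * h)"
    have "e \<in> D" unfolding e_def y_def by (rule all) simp
    have "d - y = (d - 1) * (1 - a * g) + 1" by (simp add: y_def algebra_simps)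
    also have "1 - a * g = b * h" using ab by (simp add: algebra_simps)
    finally have eq: "d - y = (d - 1) * (b * h) + 1" .
    have e_h: "coprime e h"
    proof (rule coprimeI)
      fix c assume c: "c dvd e" "c dvd h"
      have "c dvd d - y" using c(1) by (simp add: e_def)
      moreover have "c dvd (d - 1) * (b * h)" using c(2) by (intro dvd_mult)
      ultimately have "c dvd (d - y) - (d - 1) * (b * h)" by (rule dvd_diff)
      then show "is_unit c" by (simp add: eq)
    qed
    moreover have "e dvd g * h" unfolding e_def by simp
    ultimately have "e dvd g" using coprime_dvd_mult_left_iff by blast
    then have "e dvd (d - y) + y" unfolding y_def
      by (intro dvd_add dvd_mult) (auto simp: e_def y_def)
    then have "e = d" using antichain[OF \<open>e \<in> D\<close> d] by auto
    then show ?thesis using e_h by simp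
  qed
  ultimately show False using h by (meson coprime_common_divisor dvd_refl)
qed

section \<open>From homogeneous vertex sets to sets of polynomials\<close>

text \<open>
  Once a vertex of \<open>X\<close> has been translated to \<open>0\<close>, a second vertex of \<open>X\<close> becomes an element of
  \<open>P\<close> that is not a multiple of \<open>f\<close>, and a vertex outside \<open>X\<close> shows that \<open>P\<close> is proper.
\<close>

lemma nontrivial_homogeneous_set_proper_homogeneous:
  fixes f :: "'a :: {finite, field_gcd} poly"
  assumes f: "f \<noteq> 0" and X: "homogeneous_set (gcd_graph f D) X"
    and two: "2 \<le> card X" and small: "card X < card (pverts (gcd_graph f D))"
  obtains P p where "proper_homogeneous f D P" "p \<in> P" "\<not> f dvd p"
proof -
  let ?c = "\<lambda>p. poly_cong_rel f `` {p}"
  let ?E = "\<lambda>p q. gcd (p - q) f \<in> D"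
  define Y where "Y = {p. ?c p \<in> X}"
  have V: "pverts (gcd_graph f D) = poly_residue_classes f" by (simp add: gcd_graph_def)
  have sub: "X \<subseteq> poly_residue_classes f" using X by (simp add: homogeneous_set_def V)
  obtain u v where uv: "u \<in> X" "v \<in> X" "u \<noteq> v"
    using two by (metis card_2_iff' obtain_subset_with_card_n subsetD)
  obtain a b where ab: "u = ?c a" "v = ?c b"
    using uv sub poly_residue_class_cases by (metis subsetD)
  have "X \<noteq> poly_residue_classes f" using small V by auto
  then obtain c where c: "c \<notin> Y"
    unfolding Y_def using sub poly_residue_class_cases by (metis mem_Collect_eq subsetI subset_antisym)
  have a: "a \<in> Y" and b: "b \<in> Y" and nab: "\<not> f dvd b - a"
    using ab uv residue_class_eq_iff by (auto simp: Y_def)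
  have closed: "residue_closed f Y"
    unfolding residue_closed_def Y_def using residue_class_eq_iff
    by (metis (no_types, lifting) mem_Collect_eq)
  have hom: "rel_homogeneous ?E Y"
    unfolding rel_homogeneous_def
  proof (intro allI impI ballI)
    fix r x y assume "r \<notin> Y" "x \<in> Y" "y \<in> Y"
    then have "?c r \<in> pverts (gcd_graph f D) - X" "?c x \<in> X" "?c y \<in> X"
      using residue_class_in_vertices by (auto simp: Y_def V)
    then have "(?c r, ?c x) \<in> parcs (gcd_graph f D) \<longleftrightarrow> (?c r, ?c y) \<in> parcs (gcd_graph f D)"
      using X unfolding homogeneous_set_def by blast
    then show "?E r x \<longleftrightarrow> ?E r y" by (simp only: gcd_graph_adjacent_iff)
  qed
  have "proper_homogeneous f D {p. p + a \<in> Y}"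
    using closed hom _ a
  proof (rule proper_homogeneous_translate)
    show "Y \<noteq> UNIV" using c by blast
  qed
  moreover have "b - a \<in> {p. p + a \<in> Y}" using b by simp
  ultimately show ?thesis using that nab by blast
qed

section \<open>Primality\<close>

theorem corollary5p7:
  fixes f :: "'a :: {finite, field_gcd} poly" and D :: "'a poly set"
  assumes "lead_coeff f = 1" and "squarefree f"
    and "connected (with_proj (gcd_graph f {1}))"
    and "D \<noteq> {}"
    and "\<And>d. d \<in> D \<Longrightarrow> lead_coeff d = 1 \<and> d dvd f"
    and "f \<notin> D"
    and "\<And>g h. g \<in> D \<Longrightarrow> h \<in> D \<Longrightarrow> g \<noteq> h \<Longrightarrow> \<not> g dvd h"
    and "connected (with_proj (gcd_graph f D))"
    and "anti_connected (gcd_graph f D)"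
  shows "prime_graph (gcd_graph f D)"
  unfolding prime_graph_def
proof
  assume "\<exists>X. homogeneous_set (gcd_graph f D) X \<and> 2 \<le> card X \<and> card X < card (pverts (gcd_graph f D))"
  moreover have f: "f \<noteq> 0" using assms(1) by auto
  ultimately obtain P p where P: "proper_homogeneous f D P" and p: "p \<in> P" "\<not> f dvd p"
    using nontrivial_homogeneous_set_proper_homogeneous by blast
  obtain M where M: "proper_homogeneous f D M"
    and max: "\<And>Q. proper_homogeneous f D Q \<Longrightarrow> Q \<subseteq> M"
    using largest_proper_homogeneous[OF f assms(8,9) P] by blast
  note ideal = largest_proper_homogeneous_ideal[OF assms(3) M max]
  have "f \<in> M"
    using M residue_closedD[of f M 0 f] by (simp add: proper_homogeneous_def)
  then obtain g where Mg: "M = {p. g dvd p}"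
    using poly_ideal_principal[OF ideal] f by blast
  obtain h where fgh: "f = g * h" using \<open>f \<in> M\<close> Mg by (auto elim: dvdE)
  \<comment> \<open>\<open>p\<close> is a multiple of \<open>g\<close> but not of \<open>f\<close>, so the cofactor \<open>h\<close> is no unit.\<close>
  have "g dvd p" using max[OF P] p(1) Mg by blast
  then have h: "\<not> is_unit h"
    using p(2) fgh by (metis mult_unit_dvd_iff)
  have cop: "coprime g h"
    using assms(2) squarefree_multD[of g h] fgh
    by (metis coprimeI dvd_mult_cancel_left mult_dvd_mono power2_eq_square squarefree_def)
  have hom: "rel_homogeneous (\<lambda>p q. gcd (p - q) (g * h) \<in> D) {p. g dvd p}"
    using M Mg fgh by (simp add: proper_homogeneous_def)
  have gD: "g dvd d" if "d \<in> D" for d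
    using homogeneous_ideal_generator_dvd[OF cop h hom] assms(5,7) that fgh by blast
  have "M = UNIV"
  proof (rule connected_gcd_graph_residue_closed[OF assms(8)])
    fix p q assume "p \<in> M" "gcd (p - q) f \<in> D"
    then have "g dvd p" "g dvd p - q" using gD[of "gcd (p - q) f"] Mg by auto
    then have "g dvd p - (p - q)" by (rule dvd_diff)
    then show "q \<in> M" using Mg by simp
  qed (use M in \<open>auto simp: proper_homogeneous_def\<close>)
  then show False using M by (simp add: proper_homogeneous_def)
qed

end
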